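(* Let $p\in(0,1)$, let $B_1,B_2,\ldots$ be i.i.d. random variables with $\mathbf{P}(B_i=1)=1-\mathbf{P}(B_i=0)=p$, and let $M(p)=\sup_{n\in\mathbf{N}} n^{-1}(B_1+\cdots+B_n)$. Let $t\in\mathbf{N}$ with $pt\le 1$. Then $$\mathbf{P}(M(p)\in(1/(k+1),1/k])=\frac{p}{1-p}\quad\text{for every } k\in\{1,\ldots,t-1\},$$ and $$\mathbf{P}(M(p)\in(p,1/t])=\frac{1-tp}{1-p}.$$
   Context: $\mathbf{N}=\{1,2,\ldots\}$. *)

theory Defs
  imports "HOL-Probability.Probability"
begin

text \<open>
  The supremum is taken in the extended reals, so that it is meaningful also on the null set of
  outcomes where some \<open>B i\<close> takes a value outside \<open>{0, 1}\<close>. Sequences are indexed from 1: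
  \<open>B 0\<close> is never used.
\<close>

definition sup_mean :: "(nat \<Rightarrow> 'a \<Rightarrow> real) \<Rightarrow> 'a \<Rightarrow> ereal" where
  "sup_mean B \<omega> = (SUP n\<in>{1..}. ereal ((\<Sum>i=1..n. B i \<omega>) / real n))"

end

theory Submission
  imports Defs
begin

text \<open>
  Let \<open>S n = B 1 + \<dots> + B n\<close> and let \<open>M\<close> be the supremum of the means \<open>S n / n\<close>. Then \<open>M \<le> c\<close> means that
  the walk \<open>S\<close> never rises above the line of slope \<open>c\<close> (\<open>sup_mean_le_iff\<close>), so the theorem asks for
  the probability of this for slope \<open>1/k\<close> with \<open>p k \<le> 1\<close>, and for slope \<open>p\<close>.

  For slope \<open>1/k\<close> the walk \<open>j - k S j\<close> has integer steps that are at most 1, which makes an exact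
  ballot formula available: with \<open>f x = max 0 (1 - k x)\<close>, the event that \<open>S j \<le> j / k\<close> for all
  \<open>j \<le> n\<close> and \<open>S n = m\<close> has probability
  \<open>f (m / (n+1)) * Bernstein (n+1) m p / (1 - p)\<close> (lemma \<open>ballot\<close>). Summed over \<open>m\<close>, this is the
  Bernstein polynomial of degree \<open>n+1\<close> of \<open>f\<close> at \<open>p\<close>, divided by \<open>1 - p\<close>. It tends to
  \<open>f p / (1 - p) = (1 - k p) / (1 - p)\<close> because Bernstein polynomials of a continuous function
  converge to it (\<open>prob_sup_mean_le\<close>). Differences of these values for consecutive \<open>k\<close> are
  \<open>p / (1 - p)\<close>.

  For slope \<open>p\<close> the probability is 0 (\<open>prob_sup_mean_le_p\<close>): the centred walk has fluctuations of
  order \<open>sqrt n\<close>, so by the central limit theorem there is a \<open>\<delta> > 0\<close> such that, whatever happened up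
  to time \<open>N\<close>, a sufficiently long independent block of further steps lifts the walk above the line
  with probability at least \<open>\<delta>\<close> (\<open>block_exceeds\<close>). If \<open>c\<close> is the probability of never rising above
  the line, this gives \<open>c \<le> (1 - \<delta>) c\<close>.
\<close>

section \<open>The running mean and walks below a line\<close>

definition psum :: "(nat \<Rightarrow> 'a \<Rightarrow> real) \<Rightarrow> nat \<Rightarrow> 'a \<Rightarrow> real" where
  "psum B n \<omega> = (\<Sum>i=1..n. B i \<omega>)"

definition below :: "(nat \<Rightarrow> 'a \<Rightarrow> real) \<Rightarrow> real \<Rightarrow> nat \<Rightarrow> 'a \<Rightarrow> bool" where
  "below B c n \<omega> \<longleftrightarrow> (\<forall>j\<in>{1..n}. psum B j \<omega> \<le> c * real j)"

lemma psum_0 [simp]: "psum B 0 \<omega> = 0"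
  by (simp add: psum_def)

lemma psum_Suc: "psum B (Suc n) \<omega> = psum B n \<omega> + B (Suc n) \<omega>"
  by (simp add: psum_def)

lemma below_0 [simp]: "below B c 0 \<omega>"
  by (simp add: below_def)

lemma below_Suc:
  "below B c (Suc n) \<omega> \<longleftrightarrow> below B c n \<omega> \<and> psum B (Suc n) \<omega> \<le> c * real (Suc n)"
  by (auto simp: below_def atLeastAtMostSuc_conv)

lemma below_antimono: "m \<le> n \<Longrightarrow> below B c n \<omega> \<Longrightarrow> below B c m \<omega>"
  by (auto simp: below_def)

lemma sup_mean_le_iff: "sup_mean B \<omega> \<le> ereal c \<longleftrightarrow> (\<forall>n. below B c n \<omega>)"
proof -
  have "sup_mean B \<omega> \<le> ereal c \<longleftrightarrow> (\<forall>n\<ge>1. psum B n \<omega> / real n \<le> c)"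
    by (auto simp: sup_mean_def SUP_le_iff psum_def)
  also have "\<dots> \<longleftrightarrow> (\<forall>n\<ge>1. psum B n \<omega> \<le> c * real n)"
    by (auto simp: divide_le_eq)
  also have "\<dots> \<longleftrightarrow> (\<forall>n. below B c n \<omega>)"
    unfolding below_def by (meson atLeastAtMost_iff order.refl)
  finally show ?thesis .
qed

section \<open>Recurrences for Bernstein polynomials\<close>

text \<open>
  The next two identities express both ways of reaching \<open>m\<close> successes in \<open>n + 1\<close> trials as fractions
  of the same binomial weight; they put the recursion behind the ballot formula over one common
  factor.
\<close>

lemma Bernstein_Suc_same:
  "(1 - x) * Bernstein n m x = (1 - real m / real (Suc n)) * Bernstein (Suc n) m x"
proof (cases "m \<le> n")
  case True
  have "(Suc n - m) * (Suc n choose m) = Suc n * (n choose m)"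
    using binomial_absorb_comp [of "Suc n" m] by simp
  then have "real (Suc n - m) * real (Suc n choose m) = real (Suc n) * real (n choose m)"
    by (metis of_nat_mult)
  moreover have "real (Suc n - m) = real (Suc n) - real m"
    using True by simp
  ultimately have "real (n choose m) = (1 - real m / real (Suc n)) * real (Suc n choose m)"
    by (simp add: field_simps)
  then show ?thesis
    using True by (simp add: Bernstein_def Suc_diff_le del: of_nat_Suc)
next
  case False
  then show ?thesis
    by (cases "m = Suc n") (simp_all add: Bernstein_def binomial_eq_0 del: of_nat_Suc)
qed

lemma Bernstein_Suc_Suc:
  "x * Bernstein n m x = real (Suc m) / real (Suc n) * Bernstein (Suc n) (Suc m) x"
proof -
  have "real (Suc m) * real (Suc n choose Suc m) = real (Suc n) * real (n choose m)"
    by (metis Suc_times_binomial of_nat_mult)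
  then have "real (n choose m) = real (Suc m) / real (Suc n) * real (Suc n choose Suc m)"
    by (simp add: field_simps del: binomial_Suc_Suc)
  then show ?thesis
    by (simp add: Bernstein_def del: of_nat_Suc binomial_Suc_Suc)
qed

section \<open>Bernoulli trials\<close>

locale bernoulli_trials = prob_space +
  fixes B :: "nat \<Rightarrow> 'a \<Rightarrow> real" and p :: real
  assumes p_pos: "0 < p" and p_less_1: "p < 1"
    and indep: "indep_vars (\<lambda>_. borel) B {1..}"
    and prob_1: "i \<ge> 1 \<Longrightarrow> prob {\<omega> \<in> space M. B i \<omega> = 1} = p"
    and prob_0: "i \<ge> 1 \<Longrightarrow> prob {\<omega> \<in> space M. B i \<omega> = 0} = 1 - p"
begin

lemma measurable_B [measurable]: "i \<ge> 1 \<Longrightarrow> B i \<in> borel_measurable M"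
  using indep by (auto simp: indep_vars_def2)

lemma measurable_psum [measurable]: "psum B n \<in> borel_measurable M"
  unfolding psum_def [abs_def] by (intro borel_measurable_sum) auto

lemma measurable_below [measurable]: "Measurable.pred M (below B c n)"
  unfolding below_def [abs_def] by measurable

lemma AE_01:
  assumes "i \<ge> 1"
  shows "AE \<omega> in M. B i \<omega> = 0 \<or> B i \<omega> = 1"
proof -
  note [measurable] = measurable_B [OF assms]
  have "prob {\<omega>\<in>space M. B i \<omega> = 0 \<or> B i \<omega> = 1}
      = prob ({\<omega>\<in>space M. B i \<omega> = 0} \<union> {\<omega>\<in>space M. B i \<omega> = 1})"
    by (rule arg_cong [where f = prob]) auto
  also have "\<dots> = prob {\<omega>\<in>space M. B i \<omega> = 0} + prob {\<omega>\<in>space M. B i \<omega> = 1}"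
    by (intro finite_measure_Union) auto
  also have "\<dots> = 1"
    using assms by (simp add: prob_0 prob_1)
  finally show ?thesis
    by (subst (asm) prob_Collect_eq_1) auto
qed

lemma AE_all_01: "AE \<omega> in M. \<forall>i\<in>{1..}. B i \<omega> = 0 \<or> B i \<omega> = 1"
  by (intro AE_ball_countable') (auto intro: AE_01)

lemma psum_natural:
  assumes "\<forall>i\<in>{1..}. B i \<omega> = 0 \<or> B i \<omega> = 1"
  shows "\<exists>m\<le>n. psum B n \<omega> = real m"
proof (induction n)
  case (Suc n)
  then obtain m where m: "m \<le> n" "psum B n \<omega> = real m"
    by blast
  show ?case
  proof (cases "B (Suc n) \<omega> = 0")
    case True
    with m show ?thesis
      by (intro exI [of _ m]) (auto simp: psum_Suc)
  next
    case False
    with assms have "B (Suc n) \<omega> = 1"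
      by (metis atLeast_iff le_add1 plus_1_eq_Suc)
    with m show ?thesis
      by (intro exI [of _ "Suc m"]) (auto simp: psum_Suc)
  qed
qed simp

text \<open>
  The Markov property of the walk: its path up to time \<open>n\<close> is a function of the first \<open>n\<close> trials, its
  increment from \<open>n\<close> to \<open>m\<close> one of the trials after \<open>n\<close>. With \<open>m = n + 1\<close> it drives the
  ballot recursion, with \<open>m\<close> large the argument for slope \<open>p\<close>.
\<close>

lemma prob_below_block:
  assumes [measurable]: "A \<in> sets borel" "D \<in> sets borel"
  shows "prob {\<omega>\<in>space M. (below B c n \<omega> \<and> psum B n \<omega> \<in> A) \<and> (\<Sum>i=n+1..m. B i \<omega>) \<in> D}
       = prob {\<omega>\<in>space M. below B c n \<omega> \<and> psum B n \<omega> \<in> A}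
         * prob {\<omega>\<in>space M. (\<Sum>i=n+1..m. B i \<omega>) \<in> D}"
proof -
  let ?P1 = "PiM {1..n} (\<lambda>_. borel :: real measure)"
  let ?P2 = "PiM {n+1..m} (\<lambda>_. borel :: real measure)"
  define Q where "Q x \<longleftrightarrow> (\<forall>j\<in>{1..n}. (\<Sum>i=1..j. x i) \<le> c * real j) \<and> (\<Sum>i=1..n. x i) \<in> A"
    for x :: "nat \<Rightarrow> real"
  define R where "R x \<longleftrightarrow> (\<Sum>i=n+1..m. x i) \<in> D" for x :: "nat \<Rightarrow> real"
  have 1: "(\<lambda>x. \<Sum>i=1..j. x i) \<in> borel_measurable ?P1" if "j \<le> n" for j
    using that by (intro borel_measurable_sum measurable_component_singleton) auto
  have 2: "(\<lambda>x. \<Sum>i=n+1..m. x i) \<in> borel_measurable ?P2"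
    by (intro borel_measurable_sum measurable_component_singleton) auto
  have Q: "{x\<in>space ?P1. Q x} \<in> sets ?P1"
  proof -
    have "Measurable.pred ?P1 (\<lambda>x. (\<Sum>i=1..j. x i) \<le> c * real j)" if "j \<in> {1..n}" for j
    proof -
      from that have "j \<le> n"
        by simp
      note [measurable] = 1 [OF this]
      show ?thesis
        by measurable
    qed
    moreover have "Measurable.pred ?P1 (\<lambda>x. (\<Sum>i=1..n. x i) \<in> A)"
      using 1 [of n] by measurable
    ultimately have "Measurable.pred ?P1 Q"
      unfolding Q_def [abs_def]
      by (intro pred_intros_logic pred_intros_finite) auto
    then show ?thesis
      by simp
  qed
  have R: "{x\<in>space ?P2. R x} \<in> sets ?P2"
    unfolding R_def using 2 by measurable
  have ind: "indep_var ?P1 (\<lambda>\<omega>. restrict (\<lambda>i. B i \<omega>) {1..n}) ?P2 (\<lambda>\<omega>. restrict (\<lambda>i. B i \<omega>) {n+1..m})"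
    by (intro indep_var_restrict [OF indep]) auto
  have Q_eq: "Q (restrict (\<lambda>i. B i \<omega>) {1..n}) \<longleftrightarrow> below B c n \<omega> \<and> psum B n \<omega> \<in> A" for \<omega>
    by (simp add: Q_def below_def psum_def)
  have R_eq: "R (restrict (\<lambda>i. B i \<omega>) {n+1..m}) \<longleftrightarrow> (\<Sum>i=n+1..m. B i \<omega>) \<in> D" for \<omega>
    by (simp add: R_def)
  have sp: "restrict (\<lambda>i. B i \<omega>) J \<in> space (PiM J (\<lambda>_. borel))" for \<omega> J
    by (simp add: space_PiM)
  show ?thesis
    using indep_varD [OF ind Q R]
    by (simp add: vimage_def Int_def Q_eq R_eq sp conj_commute del: One_nat_def Suc_eq_plus1 add_Suc_right)
qed

section \<open>The ballot formula and slopes \<open>1/k\<close>\<close>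

lemma prob_below_step:
  "prob {\<omega>\<in>space M. below B c n \<omega> \<and> psum B (Suc n) \<omega> = x}
       = (1 - p) * prob {\<omega>\<in>space M. below B c n \<omega> \<and> psum B n \<omega> = x}
         + p * prob {\<omega>\<in>space M. below B c n \<omega> \<and> psum B n \<omega> = x - 1}"
proof -
  have B [measurable]: "B (Suc n) \<in> borel_measurable M"
    by (rule measurable_B) simp
  let ?E = "\<lambda>y b. {\<omega>\<in>space M. (below B c n \<omega> \<and> psum B n \<omega> = y) \<and> B (Suc n) \<omega> = b}"
  have "prob {\<omega>\<in>space M. below B c n \<omega> \<and> psum B (Suc n) \<omega> = x} = prob (?E x 0 \<union> ?E (x - 1) 1)"
  proof (rule finite_measure_eq_AE)
    show "AE \<omega> in M. \<omega> \<in> {\<omega>\<in>space M. below B c n \<omega> \<and> psum B (Suc n) \<omega> = x}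
            \<longleftrightarrow> \<omega> \<in> ?E x 0 \<union> ?E (x - 1) 1"
      using AE_01 [of "Suc n", simplified] by eventually_elim (auto simp: psum_Suc)
  qed measurable
  also have "\<dots> = prob (?E x 0) + prob (?E (x - 1) 1)"
    by (intro finite_measure_Union) auto
  moreover have "prob (?E y b) = prob {\<omega>\<in>space M. below B c n \<omega> \<and> psum B n \<omega> = y}
                              * prob {\<omega>\<in>space M. B (Suc n) \<omega> = b}" for y b
    using prob_below_block [of "{y}" "{b}" c n "Suc n"] by simp
  ultimately show ?thesis
    by (simp only: prob_0 [of "Suc n", simplified] prob_1 [of "Suc n", simplified] mult.commute)
qed

text \<open>
  Induction on \<open>n\<close> by conditioning on the last step. If \<open>k m \<le> n + 1\<close>, the constraint at time \<open>n + 1\<close>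
  is implied by the endpoint, and the recursion reduces to the identity
  \<open>(N - k m) (N + 1 - m) + (N - k (m - 1)) m = N (N + 1 - k m)\<close> with \<open>N = n + 1\<close>; otherwise both sides
  vanish. The formula vanishes exactly at \<open>k m = n + 1\<close>, the first value outside the allowed region, so the
  truncation by \<open>max\<close> is compatible with the recursion: this is where integrality of \<open>k\<close> enters.
\<close>

lemma ballot:
  assumes "k \<ge> 1"
  shows "(1 - p) * prob {\<omega>\<in>space M. below B (1 / real k) n \<omega> \<and> psum B n \<omega> = real m}
       = max 0 (1 - real k * (real m / real (Suc n))) * Bernstein (Suc n) m p"
proof (induction n arbitrary: m)
  case 0
  show ?case
  proof (cases "m = 0")
    case True
    then show ?thesis
      by (simp add: Bernstein_def prob_space)
  next
    case False
    have "real m * real k \<ge> 1"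
      using False assms by (metis One_nat_def Suc_leI mult_le_mono nat_mult_1 neq0_conv of_nat_1 of_nat_le_iff of_nat_mult)
    with False show ?thesis
      by (simp add: max_def mult.commute)
  qed
next
  case (Suc n)
  let ?G = "\<lambda>n m. prob {\<omega>\<in>space M. below B (1 / real k) n \<omega> \<and> psum B n \<omega> = real m}"
  let ?N = "real (Suc n)"
  have k: "real k > 0"
    using assms by simp
  \<comment> \<open>The last constraint depends on the endpoint alone.\<close>
  have iff: "below B (1 / real k) (Suc n) \<omega> \<and> psum B (Suc n) \<omega> = real m \<longleftrightarrow>
             k * m \<le> Suc n \<and> below B (1 / real k) n \<omega> \<and> psum B (Suc n) \<omega> = real m" for \<omega>
  proof -
    have "real m \<le> 1 / real k * real (Suc n) \<longleftrightarrow> real k * real m \<le> real (Suc n)"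
      using k by (simp add: field_simps)
    also have "\<dots> \<longleftrightarrow> k * m \<le> Suc n"
      by (metis of_nat_le_iff of_nat_mult)
    finally show ?thesis
      by (auto simp: below_Suc)
  qed
  show ?case
  proof (cases "k * m \<le> Suc n")
    case False
    then have "real k * real m \<ge> real (Suc (Suc n))"
      by (metis Suc_leI not_le of_nat_le_iff of_nat_mult)
    then have "1 - real k * (real m / real (Suc (Suc n))) \<le> 0"
      by (simp add: field_simps)
    with False show ?thesis
      by (simp add: iff max_absorb1 del: of_nat_Suc)
  next
    case le: True
    then have le': "real k * real m \<le> ?N"
      by (metis of_nat_le_iff of_nat_mult)
    show ?thesis
    proof (cases m)
      case 0
      \<comment> \<open>The second predecessor of the state 0 is -1, which the walk reaches only on a null set.\<close>
      have neg: "prob {\<omega>\<in>space M. below B (1 / real k) n \<omega> \<and> psum B n \<omega> = - 1} = 0"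
      proof -
        have "AE \<omega> in M. \<not> (below B (1 / real k) n \<omega> \<and> psum B n \<omega> = - 1)"
          using AE_all_01
        proof eventually_elim
          case (elim \<omega>)
          then obtain m where "psum B n \<omega> = real m"
            using psum_natural by blast
          then show ?case
            by auto
        qed
        then show ?thesis
          by (subst prob_Collect_eq_0) auto
      qed
      have "?G (Suc n) m = (1 - p) * ?G n 0"
        using prob_below_step [of "1 / real k" n 0] neg iff [unfolded 0] by (simp add: 0)
      then show ?thesis
        using Suc [of 0] by (simp add: 0 Bernstein_def)
    next
      case (Suc l)
      have ml: "real m - 1 = real l"
        by (simp add: Suc)
      have "?G (Suc n) m = (1 - p) * ?G n m + p * ?G n l"
        using prob_below_step [of "1 / real k" n "real m"] le unfolding ml by (simp add: iff)
      then have "(1 - p) * ?G (Suc n) m = (1 - p) * ((1 - p) * ?G n m) + p * ((1 - p) * ?G n l)"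
        by (simp only: distrib_left mult.left_commute)
      also have "\<dots> = max 0 (1 - real k * (real m / ?N)) * ((1 - p) * Bernstein (Suc n) m p)
                      + max 0 (1 - real k * (real l / ?N)) * (p * Bernstein (Suc n) l p)"
        unfolding Suc.IH by (simp only: mult_ac)
      also have "(1 - p) * Bernstein (Suc n) m p
               = (1 - real m / (?N + 1)) * Bernstein (Suc (Suc n)) m p"
        by (simp add: Bernstein_Suc_same add.commute)
      also have "p * Bernstein (Suc n) l p = real m / (?N + 1) * Bernstein (Suc (Suc n)) m p"
        by (simp add: Bernstein_Suc_Suc Suc add.commute)
      also have "max 0 (1 - real k * (real m / ?N)) = 1 - real k * (real m / ?N)"
        using le' by (simp add: max_def field_simps)
      also have "max 0 (1 - real k * (real l / ?N)) = 1 - real k * ((real m - 1) / ?N)"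
      proof -
        have "real k * real l \<le> ?N"
          using le' by (simp add: Suc algebra_simps)
        then show ?thesis
          unfolding ml by (simp add: max_def field_simps)
      qed
      also have "(1 - real k * (real m / ?N)) * ((1 - real m / (?N + 1)) * Bernstein (Suc (Suc n)) m p)
          + (1 - real k * ((real m - 1) / ?N)) * (real m / (?N + 1) * Bernstein (Suc (Suc n)) m p)
          = (1 - real k * (real m / (?N + 1))) * Bernstein (Suc (Suc n)) m p"
        by (simp add: divide_simps) (simp add: algebra_simps)
      also have "1 - real k * (real m / (?N + 1)) = max 0 (1 - real k * (real m / real (Suc (Suc n))))"
        using le' by (simp add: max_def field_simps)
      finally show ?thesis .
    qed
  qed
qed

lemma prob_below:
  assumes "k \<ge> 1"
  shows "prob {\<omega>\<in>space M. below B (1 / real k) n \<omega>}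
       = (\<Sum>m\<le>Suc n. max 0 (1 - real k * (real m / real (Suc n))) * Bernstein (Suc n) m p) / (1 - p)"
proof -
  let ?A = "\<lambda>m. {\<omega>\<in>space M. below B (1 / real k) n \<omega> \<and> psum B n \<omega> = real m}"
  have "prob {\<omega>\<in>space M. below B (1 / real k) n \<omega>} = prob (\<Union>m\<le>Suc n. ?A m)"
  proof (rule finite_measure_eq_AE)
    show "AE \<omega> in M. \<omega> \<in> {\<omega>\<in>space M. below B (1 / real k) n \<omega>} \<longleftrightarrow> \<omega> \<in> (\<Union>m\<le>Suc n. ?A m)"
      using AE_all_01
    proof eventually_elim
      case (elim \<omega>)
      then obtain m where "m \<le> n" "psum B n \<omega> = real m"
        using psum_natural by blast
      then show ?case
        by auto
    qed
  qed measurable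
  also have "\<dots> = (\<Sum>m\<le>Suc n. prob (?A m))"
    by (intro finite_measure_finite_Union) (auto simp: disjoint_family_on_def)
  also have "\<dots> = (\<Sum>m\<le>Suc n. max 0 (1 - real k * (real m / real (Suc n))) * Bernstein (Suc n) m p / (1 - p))"
    using ballot [OF assms] p_less_1 by (intro sum.cong) (simp_all add: field_simps)
  finally show ?thesis
    by (simp only: sum_divide_distrib)
qed

text \<open>Continuity from above, for the decreasing events of staying below the line up to time \<open>n\<close>.\<close>

lemma prob_below_tendsto:
  "(\<lambda>n. prob {\<omega>\<in>space M. below B c n \<omega>}) \<longlonglongrightarrow> prob {\<omega>\<in>space M. sup_mean B \<omega> \<le> ereal c}"
proof -
  have "{\<omega>\<in>space M. sup_mean B \<omega> \<le> ereal c} = (\<Inter>n. {\<omega>\<in>space M. below B c n \<omega>})"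
    by (auto simp: sup_mean_le_iff)
  moreover have "decseq (\<lambda>n. {\<omega>\<in>space M. below B c n \<omega>})"
    by (auto simp: decseq_def intro: below_antimono)
  moreover have "range (\<lambda>n. {\<omega>\<in>space M. below B c n \<omega>}) \<subseteq> events"
    by (intro image_subsetI) measurable
  ultimately show ?thesis
    using finite_Lim_measure_decseq [of "\<lambda>n. {\<omega>\<in>space M. below B c n \<omega>}"] by simp
qed

text \<open>
  At a fixed horizon the probability is a Bernstein polynomial of \<open>x \<mapsto> max 0 (1 - k x)\<close> at \<open>p\<close>, divided
  by \<open>1 - p\<close>; Bernstein's convergence theorem takes the place of a law of large numbers. The
  hypothesis \<open>p k \<le> 1\<close> removes the truncation in the limit.
\<close>

lemma prob_sup_mean_le:
  assumes "k \<ge> 1" "p * real k \<le> 1"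
  shows "prob {\<omega>\<in>space M. sup_mean B \<omega> \<le> ereal (1 / real k)} = (1 - real k * p) / (1 - p)"
proof -
  let ?f = "\<lambda>x :: real. max 0 (1 - real k * x)"
  let ?b = "\<lambda>n. \<Sum>m\<le>n. ?f (real m / real n) * Bernstein n m p"
  have "?b \<longlonglongrightarrow> ?f p"
  proof (rule LIMSEQ_I)
    fix e :: real
    assume "e > 0"
    moreover have "continuous_on {0..1} ?f"
      by (intro continuous_intros)
    ultimately obtain N where "\<forall>n x. N \<le> n \<and> x \<in> {0..1} \<longrightarrow> \<bar>?f x - (\<Sum>m\<le>n. ?f (real m / real n) * Bernstein n m x)\<bar> < e"
      using Bernstein_Weierstrass by blast
    then show "\<exists>N. \<forall>n\<ge>N. norm (?b n - ?f p) < e"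
      using p_pos p_less_1 by (intro exI [of _ N]) (auto simp: abs_minus_commute)
  qed
  then have "(\<lambda>n. ?b (Suc n)) \<longlonglongrightarrow> ?f p"
    by (rule LIMSEQ_Suc)
  then have "(\<lambda>n. ?b (Suc n) / (1 - p)) \<longlonglongrightarrow> ?f p / (1 - p)"
    using p_less_1 by (intro tendsto_divide tendsto_const) auto
  moreover have "(\<lambda>n. ?b (Suc n) / (1 - p)) \<longlonglongrightarrow> prob {\<omega>\<in>space M. sup_mean B \<omega> \<le> ereal (1 / real k)}"
    using prob_below_tendsto [of "1 / real k"] by (simp only: prob_below [OF assms(1)])
  ultimately have "?f p / (1 - p) = prob {\<omega>\<in>space M. sup_mean B \<omega> \<le> ereal (1 / real k)}"
    by (rule LIMSEQ_unique)
  then show ?thesis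
    using assms by (simp add: max_def mult.commute)
qed

section \<open>Slope \<open>p\<close>\<close>

lemma integrable_B:
  assumes "i \<ge> 1"
  shows "integrable M (B i)"
proof (rule integrable_const_bound [where B = 1])
  show "AE \<omega> in M. norm (B i \<omega>) \<le> 1"
    using AE_01 [OF assms] by eventually_elim auto
qed (use assms in measurable)

lemma expectation_B:
  assumes "i \<ge> 1"
  shows "expectation (B i) = p"
proof -
  note [measurable] = measurable_B [OF assms]
  have "expectation (B i) = expectation (indicator {\<omega>\<in>space M. B i \<omega> = 1})"
  proof (rule integral_cong_AE)
    show "AE \<omega> in M. B i \<omega> = indicator {\<omega>\<in>space M. B i \<omega> = 1} \<omega>"
      using AE_01 [OF assms] AE_space by eventually_elim (auto simp: indicator_def)
  qed auto
  also have "\<dots> = p"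
    using assms by (simp add: prob_1)
  finally show ?thesis .
qed

lemma AE_B_square:
  assumes "i \<ge> 1"
  shows "AE \<omega> in M. (B i \<omega>)\<^sup>2 = B i \<omega>"
  using AE_01 [OF assms] by eventually_elim auto

lemma integrable_B_square:
  assumes "i \<ge> 1"
  shows "integrable M (\<lambda>\<omega>. (B i \<omega>)\<^sup>2)"
  using integrable_cong_AE [OF _ _ AE_B_square [OF assms]] integrable_B [OF assms] assms
  by simp

lemma variance_B:
  assumes "i \<ge> 1"
  shows "variance (B i) = p * (1 - p)"
proof -
  have "expectation (\<lambda>\<omega>. (B i \<omega>)\<^sup>2) = expectation (B i)"
    using assms by (intro integral_cong_AE AE_B_square) auto
  moreover have "variance (B i) = expectation (\<lambda>\<omega>. (B i \<omega>)\<^sup>2) - (expectation (B i))\<^sup>2"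
    using assms by (intro variance_eq integrable_B integrable_B_square)
  ultimately have "variance (B i) = p - p\<^sup>2"
    by (simp only: expectation_B [OF assms])
  then show ?thesis
    by (simp add: power2_eq_square right_diff_distrib)
qed

lemma distr_B:
  assumes "i \<ge> 1"
  shows "distr M borel (B i) = distr M borel (B 1)"
proof -
  have *: "prob (B i -` A \<inter> space M) = indicator A 0 * (1 - p) + indicator A 1 * p"
    if [measurable]: "A \<in> sets borel" and i: "i \<ge> 1" for A i
  proof -
    note [measurable] = measurable_B [OF i]
    let ?E = "\<lambda>b. {\<omega>\<in>space M. B i \<omega> = b \<and> b \<in> A}"
    have "prob (B i -` A \<inter> space M) = prob (?E 0 \<union> ?E 1)"
    proof (rule finite_measure_eq_AE)
      show "AE \<omega> in M. \<omega> \<in> B i -` A \<inter> space M \<longleftrightarrow> \<omega> \<in> ?E 0 \<union> ?E 1"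
        using AE_01 [OF i] by eventually_elim auto
    qed measurable
    also have "\<dots> = prob (?E 0) + prob (?E 1)"
      by (intro finite_measure_Union) auto
    also have "\<dots> = indicator A 0 * (1 - p) + indicator A 1 * p"
      using i by (simp add: indicator_def prob_0 prob_1)
    finally show ?thesis .
  qed
  show ?thesis
  proof (rule measure_eqI)
    fix A :: "real set"
    assume "A \<in> sets (distr M borel (B i))"
    then have "A \<in> sets borel"
      by simp
    then show "emeasure (distr M borel (B i)) A = emeasure (distr M borel (B 1)) A"
      using assms * [of A] by (simp add: emeasure_distr emeasure_eq_measure)
  qed simp
qed

text \<open>
  A block of \<open>n\<close> trials exceeds its mean by more than any prescribed \<open>K\<close> with probability bounded away
  from 0, since \<open>K\<close> is eventually less than one standard deviation, which grows like \<open>sqrt n\<close>. With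
  \<open>\<Phi>\<close> the standard normal distribution function, the central limit theorem gives any \<open>\<delta> < 1 - \<Phi> 1\<close>;
  half of that is taken. The order of the quantifiers matters: \<open>\<delta>\<close> serves all starting times \<open>N\<close> and
  all levels \<open>K\<close>.
\<close>

lemma block_exceeds:
  "\<exists>\<delta>>0. \<forall>N K. \<exists>n\<ge>1. prob {\<omega>\<in>space M. (\<Sum>i=N+1..N+n. B i \<omega>) \<le> p * real n + K} \<le> 1 - \<delta>"
proof -
  interpret N: real_distribution std_normal_distribution
    by (rule real_dist_normal_dist)
  let ?\<Phi> = "cdf std_normal_distribution"
  define \<sigma> where "\<sigma> = sqrt (p * (1 - p))"
  have \<sigma>: "\<sigma> > 0" "\<sigma>\<^sup>2 = p * (1 - p)"
    using p_pos p_less_1 by (simp_all add: \<sigma>_def)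
  have null_iff: "A \<in> null_sets std_normal_distribution \<longleftrightarrow> A \<in> null_sets lborel"
    if "A \<in> sets borel" for A
  proof -
    have "std_normal_density x \<noteq> 0" for x
      using normal_density_pos [of 1 0 x] by simp
    with that show ?thesis
      by (simp add: null_sets_density_iff flip: AE_iff_null_sets)
  qed
  have cont: "isCont ?\<Phi> 1"
    using null_iff [of "{1}"] by (simp add: N.isCont_cdf null_sets_def measure_def)
  have less: "?\<Phi> 1 < 1"
  proof -
    have "{1<..} \<notin> null_sets (lborel :: real measure)"
    proof
      assume "{1<..} \<in> null_sets (lborel :: real measure)"
      then have "{1<..2} \<in> null_sets (lborel :: real measure)"
        by (rule null_sets_subset) auto
      then show False
        by (simp add: null_sets_def)
    qed
    then have "measure std_normal_distribution {1<..} > 0"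
      using null_iff [of "{1<..}"]
      by (auto simp: null_sets_def N.emeasure_eq_measure zero_less_measure_iff)
    moreover have "UNIV - {..1} = {1 :: real<..}"
      by auto
    ultimately show ?thesis
      using N.prob_compl [of "{..1}"] by (simp add: cdf_def)
  qed
  define \<delta> where "\<delta> = (1 - ?\<Phi> 1) / 2"
  have "\<exists>n\<ge>1. prob {\<omega>\<in>space M. (\<Sum>i=N+1..N+n. B i \<omega>) \<le> p * real n + K} \<le> 1 - \<delta>" for N K
  proof -
    let ?X = "\<lambda>i. B (N + 1 + i)"
    let ?Z = "\<lambda>n \<omega>. (\<Sum>i<n. ?X i \<omega> - p) / sqrt (real n * \<sigma>\<^sup>2)"
    have "indep_vars (\<lambda>i. PiM {N + 1 + i} (\<lambda>_. borel)) (\<lambda>i \<omega>. restrict (\<lambda>i. B i \<omega>) {N + 1 + i}) UNIV"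
      by (rule indep_vars_restrict [OF indep]) (auto simp: disjoint_family_on_def)
    then have "indep_vars (\<lambda>_. borel) (\<lambda>i \<omega>. restrict (\<lambda>i. B i \<omega>) {N + 1 + i} (N + 1 + i)) UNIV"
      by (rule indep_vars_compose2) auto
    then have "indep_vars (\<lambda>_. borel) ?X UNIV"
      by simp
    then have "weak_conv_m (\<lambda>n. distr M borel (?Z n)) std_normal_distribution"
    proof (rule central_limit_theorem)
      show "expectation (?X i) = p" for i
        by (rule expectation_B) simp
      show "\<sigma> > 0"
        by (rule \<sigma>(1))
      show "integrable M (\<lambda>\<omega>. (?X i \<omega>)\<^sup>2)" for i
        by (rule integrable_B_square) simp
      show "variance (?X i) = \<sigma>\<^sup>2" for i
        unfolding \<sigma>(2) by (rule variance_B) simp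
      show "distr M borel (?X i) = distr M borel (B 1)" for i
        by (rule distr_B) simp
    qed
    then have "(\<lambda>n. cdf (distr M borel (?Z n)) 1) \<longlonglongrightarrow> ?\<Phi> 1"
      using cont by (simp add: weak_conv_m_def weak_conv_def)
    then have "\<forall>\<^sub>F n in sequentially. cdf (distr M borel (?Z n)) 1 < 1 - \<delta>"
      using less by (intro order_tendstoD(2)) (auto simp: \<delta>_def field_simps)
    moreover have "\<forall>\<^sub>F n in sequentially. sqrt (real n * \<sigma>\<^sup>2) \<ge> K"
    proof -
      have "filterlim (\<lambda>n. real n * \<sigma>\<^sup>2) at_top sequentially"
        using \<sigma>(1) by (intro filterlim_at_top_mult_tendsto_pos [OF tendsto_const] filterlim_real_sequentially) simp
      then have "filterlim (\<lambda>n. sqrt (real n * \<sigma>\<^sup>2)) at_top sequentially"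
        by (rule filterlim_compose [OF sqrt_at_top])
      then show ?thesis
        by (simp add: filterlim_at_top)
    qed
    moreover have "\<forall>\<^sub>F n in sequentially. n \<ge> 1"
      by (rule eventually_ge_at_top)
    ultimately have "\<forall>\<^sub>F n in sequentially. n \<ge> 1 \<and>
        prob {\<omega>\<in>space M. (\<Sum>i=N+1..N+n. B i \<omega>) \<le> p * real n + K} \<le> 1 - \<delta>"
    proof eventually_elim
      case (elim n)
      have meas [measurable]: "?Z n \<in> borel_measurable M"
        by measurable
      have "prob {\<omega>\<in>space M. (\<Sum>i=N+1..N+n. B i \<omega>) \<le> p * real n + K}
          \<le> prob {\<omega>\<in>space M. ?Z n \<omega> \<le> 1}"
      proof (intro finite_measure_mono subsetI)
        fix \<omega>
        assume "\<omega> \<in> {\<omega>\<in>space M. (\<Sum>i=N+1..N+n. B i \<omega>) \<le> p * real n + K}"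
        then have *: "\<omega> \<in> space M" "(\<Sum>i=N+1..N+n. B i \<omega>) \<le> p * real n + K"
          by auto
        have "(\<Sum>i=N+1..N+n. B i \<omega>) = (\<Sum>i<n. ?X i \<omega>)"
          by (rule sum.reindex_bij_witness [of _ "\<lambda>i. N + 1 + i" "\<lambda>i. i - (N + 1)"]) auto
        with * elim have "(\<Sum>i<n. ?X i \<omega> - p) \<le> sqrt (real n * \<sigma>\<^sup>2)"
          by (simp add: sum_subtractf mult.commute)
        moreover have "sqrt (real n * \<sigma>\<^sup>2) > 0"
          using elim \<sigma>(1) by simp
        ultimately show "\<omega> \<in> {\<omega>\<in>space M. ?Z n \<omega> \<le> 1}"
          using * by (simp add: divide_le_eq)
      qed measurable
      also have "\<dots> = cdf (distr M borel (?Z n)) 1"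
        using meas by (auto simp: cdf_def measure_distr vimage_def Int_def conj_commute)
      finally show ?case
        using elim by simp
    qed
    then show ?thesis
      using eventually_happens' [OF sequentially_bot] by fastforce
  qed
  moreover have "\<delta> > 0"
    using less by (simp add: \<delta>_def)
  ultimately show ?thesis
    by blast
qed

text \<open>
  Since \<open>S N \<ge> 0\<close>, staying below the line at time \<open>N + n\<close> forces the increment after \<open>N\<close> to be at most
  \<open>p n + p N\<close>. The level \<open>K = p N\<close> is a constant once \<open>N\<close> is fixed, so \<open>n\<close> can be chosen to make this
  cost a factor \<open>1 - \<delta>\<close>, independently of the first \<open>N\<close> trials; then let \<open>N\<close> tend to infinity.
\<close>

lemma prob_sup_mean_le_p: "prob {\<omega>\<in>space M. sup_mean B \<omega> \<le> ereal p} = 0"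
proof -
  let ?a = "\<lambda>n. prob {\<omega>\<in>space M. below B p n \<omega>}"
  let ?c = "prob {\<omega>\<in>space M. sup_mean B \<omega> \<le> ereal p}"
  obtain \<delta> where \<delta>: "\<delta> > 0"
    "\<And>N K. \<exists>n\<ge>1. prob {\<omega>\<in>space M. (\<Sum>i=N+1..N+n. B i \<omega>) \<le> p * real n + K} \<le> 1 - \<delta>"
    using block_exceeds by blast
  have lim: "?a \<longlonglongrightarrow> ?c"
    by (rule prob_below_tendsto)
  have "decseq ?a"
    by (intro decseq_SucI finite_measure_mono) (auto simp: below_Suc)
  have "?c \<le> (1 - \<delta>) * ?a N" for N
  proof -
    obtain n where n: "n \<ge> 1"
      "prob {\<omega>\<in>space M. (\<Sum>i=N+1..N+n. B i \<omega>) \<le> p * real n + p * real N} \<le> 1 - \<delta>"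
      using \<delta>(2) by blast
    have "?c \<le> ?a (N + n)"
      using decseq_ge [OF \<open>decseq ?a\<close> lim] .
    also have "\<dots> \<le> prob {\<omega>\<in>space M. (below B p N \<omega> \<and> psum B N \<omega> \<in> UNIV) \<and>
                            (\<Sum>i=N+1..N+n. B i \<omega>) \<in> {..p * real n + p * real N}}"
    proof (rule finite_measure_mono_AE)
      show "AE \<omega> in M. \<omega> \<in> {\<omega>\<in>space M. below B p (N + n) \<omega>} \<longrightarrow>
              \<omega> \<in> {\<omega>\<in>space M. (below B p N \<omega> \<and> psum B N \<omega> \<in> UNIV) \<and>
                            (\<Sum>i=N+1..N+n. B i \<omega>) \<in> {..p * real n + p * real N}}"
        using AE_all_01
      proof eventually_elim
        case (elim \<omega>)
        have "psum B (N + n) \<omega> = psum B N \<omega> + (\<Sum>i=N+1..N+n. B i \<omega>)"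
          unfolding psum_def by (intro sum.ub_add_nat) simp
        moreover have "psum B N \<omega> \<ge> 0"
          using psum_natural [OF elim, of N] by auto
        moreover have "psum B (N + n) \<omega> \<le> p * real (N + n)" if "below B p (N + n) \<omega>"
          using that n(1) unfolding below_def by (auto dest: bspec [of _ _ "N + n"])
        ultimately show ?case
          using below_antimono [of N "N + n"] by (auto simp: algebra_simps)
      qed
    qed measurable
    also have "\<dots> = ?a N * prob {\<omega>\<in>space M. (\<Sum>i=N+1..N+n. B i \<omega>) \<le> p * real n + p * real N}"
      by (subst prob_below_block) simp_all
    also have "\<dots> \<le> ?a N * (1 - \<delta>)"
      using n(2) by (intro mult_left_mono) auto
    finally show ?thesis
      by (simp add: mult.commute)
  qed
  then have "?c \<le> (1 - \<delta>) * ?c"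
    by (intro LIMSEQ_le_const [OF tendsto_mult_left [OF lim]]) auto
  then have "\<delta> * ?c \<le> 0"
    by (simp add: algebra_simps)
  then show ?thesis
    using \<delta>(1) by (simp add: mult_le_0_iff measure_le_0_iff)
qed

section \<open>The law of the supremum\<close>

lemma measurable_sup_mean [measurable]: "sup_mean B \<in> borel_measurable M"
proof -
  have "sup_mean B = (\<lambda>\<omega>. SUP n\<in>{1..}. ereal (psum B n \<omega> / real n))"
    by (simp add: sup_mean_def psum_def fun_eq_iff)
  then show ?thesis
    by simp
qed

lemma prob_sup_mean_interval:
  assumes "a \<le> b"
  shows "prob {\<omega>\<in>space M. sup_mean B \<omega> \<in> {ereal a<..ereal b}}
       = prob {\<omega>\<in>space M. sup_mean B \<omega> \<le> ereal b} - prob {\<omega>\<in>space M. sup_mean B \<omega> \<le> ereal a}"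
proof -
  have "{\<omega>\<in>space M. sup_mean B \<omega> \<in> {ereal a<..ereal b}}
      = {\<omega>\<in>space M. sup_mean B \<omega> \<le> ereal b} - {\<omega>\<in>space M. sup_mean B \<omega> \<le> ereal a}"
    by auto
  moreover have "{\<omega>\<in>space M. sup_mean B \<omega> \<le> ereal a} \<subseteq> {\<omega>\<in>space M. sup_mean B \<omega> \<le> ereal b}"
    using assms by (auto intro: order_trans)
  ultimately show ?thesis
    by (simp add: finite_measure_Diff)
qed

end

theorem mainTheorem8:
  fixes P :: "'a measure" and B :: "nat \<Rightarrow> 'a \<Rightarrow> real" and p :: real and t :: nat
  assumes "prob_space P"
    and "0 < p" and "p < 1"
    and "prob_space.indep_vars P (\<lambda>_. borel) B {1..}"
    and "\<And>i. i \<ge> 1 \<Longrightarrow> measure P {\<omega> \<in> space P. B i \<omega> = 1} = p"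
    and "\<And>i. i \<ge> 1 \<Longrightarrow> 1 - measure P {\<omega> \<in> space P. B i \<omega> = 0} = p"
    and "t \<ge> 1" and "p * real t \<le> 1"
  shows "(\<forall>k\<in>{1..t - 1}.
            measure P {\<omega> \<in> space P. sup_mean B \<omega> \<in> {ereal (1 / (real k + 1))<..ereal (1 / real k)}}
              = p / (1 - p)) \<and>
         measure P {\<omega> \<in> space P. sup_mean B \<omega> \<in> {ereal p<..ereal (1 / real t)}}
           = (1 - real t * p) / (1 - p)"
proof -
  interpret prob_space P
    by fact
  interpret bernoulli_trials P B p
  proof
    show "prob {\<omega> \<in> space P. B i \<omega> = 0} = 1 - p" if "i \<ge> 1" for i
      using assms(6) [OF that] by simp
  qed (use assms in auto)
  have "prob {\<omega> \<in> space P. sup_mean B \<omega> \<in> {ereal (1 / (real k + 1))<..ereal (1 / real k)}} = p / (1 - p)"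
    if k: "k \<in> {1..t - 1}" for k
  proof -
    have "p * real j \<le> 1" if "j \<le> t" for j
    proof -
      have "p * real j \<le> p * real t"
        using that \<open>0 < p\<close> by simp
      then show ?thesis
        using assms(8) by linarith
    qed
    moreover have "k \<le> t" "Suc k \<le> t"
      using k by auto
    ultimately have le: "p * real k \<le> 1" "p * real (Suc k) \<le> 1"
      by blast+
    have "prob {\<omega> \<in> space P. sup_mean B \<omega> \<in> {ereal (1 / real (Suc k))<..ereal (1 / real k)}}
        = (1 - real k * p) / (1 - p) - (1 - real (Suc k) * p) / (1 - p)"
      using k le by (subst prob_sup_mean_interval) (auto simp: prob_sup_mean_le frac_le simp del: of_nat_Suc)
    also have "\<dots> = p / (1 - p)"
      by (simp add: diff_divide_distrib [symmetric] algebra_simps)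
    finally show ?thesis
      by (simp add: add.commute)
  qed
  moreover have "prob {\<omega> \<in> space P. sup_mean B \<omega> \<in> {ereal p<..ereal (1 / real t)}}
      = (1 - real t * p) / (1 - p)"
  proof -
    have "p \<le> 1 / real t"
      using assms(7,8) by (simp add: field_simps)
    then show ?thesis
      using assms(7,8) by (simp add: prob_sup_mean_interval prob_sup_mean_le prob_sup_mean_le_p
          del: greaterThanAtMost_iff)
  qed
  ultimately show ?thesis
    by blast
qed

end
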